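(* Consider the zero-knowledge fairness audit described in the context, with $n$ client queries, model $M$, and soundness parameter $\nu\in\mathbb{N}$ (the number of queries uniformly sampled within each demographic group, for a total of $2\nu$). Let $Q_h=\{(q_i,r_i,M(q_i,r_i))\}_{i=1}^n$ be the honest collection of query-answer tuples, let $Q_m=\{(q_i^m,r_i^m,o_i^m)\}_{i=1}^n$ be an arbitrary collection chosen by a malicious prover and authenticated at the start of the audit, and let $X_h$ and $X_m$ be the corresponding honest and measured group fairness gaps. Let $$\epsilon=\left|X_h-X_m\right|$$ and suppose $\epsilon>0$. Then the probability $p_{\text{catch}}$ that the prover is caught (over the random group-balanced sample drawn in the audit) satisfies $$p_{\text{catch}}\;\geq\;1-\left(1-\frac{\epsilon}{2}\right)^{\nu}.$$
   Context: **Model.** A model is a map $M:\mathcal{X}\times\{0,1\}^k\to\{0,1\}$, where $\mathcal{X}$ is a feature space and $\{0,1\}^k$ is the space of random seeds. Each query point $q\in\mathcal{X}$ has a binary sensitive (demographic) attribute $s(q)\in\{0,1\}$ as one of its features. **Service phase.** There are $n$ clients. Client $i$ has a query $q_i\in\mathcal{X}$; fair random coins $r_i\in\{0,1\}^k$ are jointly generated by client $i$ and the prover (service provider). The client receives from the prover an output $\tilde o_i\in\{0,1\}$ (an honest prover returns $\tilde o_i=M(q_i,r_i)$; a malicious one may return anything) and sends the verifier (auditor) a binding and hiding commitment to $(q_i,r_i,\tilde o_i)$, as well as data that binds the prover to the sensitive attribute $s(q_i)$. Prover, verifier and clients do not collude, and clients are honest. **Honest and measured gaps.** The honest collection is $Q_h=\{(q_i,r_i,o_i)\}_{i=1}^n$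 with $o_i=M(q_i,r_i)$ for all $i$ (queries answered by correct inference with $M$, and no modification of the recorded queries). For a collection $Q=\{(q_i',r_i',o_i')\}_{i=1}^n$ with $o_i'\in\{0,1\}$, containing at least one query with each attribute value, its demographic parity gap is $$X(Q)=\left|\frac{\sum_{i:\,s(q_i')=0}o_i'}{\#\{i:s(q_i')=0\}}-\frac{\sum_{i:\,s(q_i')=1}o_i'}{\#\{i:s(q_i')=1\}}\right|.$$ Then $X_h=X(Q_h)$ and $X_m=X(Q_m)$. **Audit phase.** 1. The prover authenticates (irrevocably fixes, hidden from the verifier) the model $M$ and a collection $Q_m=\{(q_i^m,r_i^m,o_i^m)\}_{i=1}^n$, with $q_i^m\in\mathcal{X}$, $r_i^m\in\{0,1\}^k$, $o_i^m\in\{0,1\}$. The model $M$ authenticated here is the one used in the definition of $Q_h$. 2. The measured gap $X_m$ is computed in zero knowledge from $Q_m$ and compared with a public threshold. 3. Only after step 1, a group-balanced uniform sample $S\subseteq\{1,\dots,n\}$ is drawn: for each $a\in\{0,1\}$ independently, the indices $i$ with $s(q_i^m)=a$ are put in uniformly random order (by randomness of the verifier, independent of $Q_m$) and the first $\nu$ of them are put in $S$. 4. Sensitive attribute check, for every $i\in\{1,\dots,n\}$: it is verified that $s(q_i^m)=s(q_i)$. 5. For every $i\in S$: a commitment consistency check verifies $(q_i^m,r_i^m,o_i^m)=(q_i,r_i,\tilde o_i)$, and an inference correctness check verifies $o_i^m=M(q_i^m,r_i^m)$. The prover is *caught* if any verification in the audit fails (the audit then aborts). The underlying cryptographic primitives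 (zero-knowledge proofs, commitments, sensitive attribute check strings) are treated as ideal: any failing check in steps 4 and 5, and any deviation from the prescribed computation in steps 2 and 3, is always detected, negligible cryptographic failure probabilities being disregarded. *)

theory Defs
  imports "HOL-Probability.Probability" "HOL-Combinatorics.Multiset_Permutations"
begin

text \<open>
  Bits are of type \<^typ>\<open>bool\<close>, and the seed space \<open>{0,1}\<^sup>k\<close> consists of the Boolean lists of
  length \<open>k\<close>.  A model is only ever applied to seeds from that space.
  A collection is indexed by \<open>{1..n}\<close>; its values at other indices are irrelevant.
\<close>

type_synonym 'x model = "'x \<Rightarrow> bool list \<Rightarrow> bool"
type_synonym 'x entry = "'x \<times> bool list \<times> bool"
type_synonym 'x collection = "nat \<Rightarrow> 'x entry"

fun query :: "'x entry \<Rightarrow> 'x" where "query (q, r, b) = q"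
fun seed :: "'x entry \<Rightarrow> bool list" where "seed (q, r, b) = r"
fun outcome :: "'x entry \<Rightarrow> bool" where "outcome (q, r, b) = b"

definition group :: "nat \<Rightarrow> ('x \<Rightarrow> bool) \<Rightarrow> 'x collection \<Rightarrow> bool \<Rightarrow> nat set" where
  "group n s Q a = {i \<in> {1..n}. s (query (Q i)) = a}"

text \<open>Both groups have to be inhabited for the demographic parity gap to be meaningful.\<close>

definition valid_collection :: "nat \<Rightarrow> nat \<Rightarrow> ('x \<Rightarrow> bool) \<Rightarrow> 'x collection \<Rightarrow> bool" where
  "valid_collection n k s Q \<longleftrightarrow>
     (\<forall>i\<in>{1..n}. length (seed (Q i)) = k) \<and> (\<forall>a. group n s Q a \<noteq> {})"

definition positive_rate :: "nat \<Rightarrow> ('x \<Rightarrow> bool) \<Rightarrow> 'x collection \<Rightarrow> bool \<Rightarrow> real" where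
  "positive_rate n s Q a =
     (\<Sum>i\<in>group n s Q a. of_bool (outcome (Q i))) / real (card (group n s Q a))"

definition parity_gap :: "nat \<Rightarrow> ('x \<Rightarrow> bool) \<Rightarrow> 'x collection \<Rightarrow> real" where
  "parity_gap n s Q = \<bar>positive_rate n s Q False - positive_rate n s Q True\<bar>"

definition honest_collection ::
    "'x model \<Rightarrow> (nat \<Rightarrow> 'x) \<Rightarrow> (nat \<Rightarrow> bool list) \<Rightarrow> 'x collection" where
  "honest_collection M q r = (\<lambda>i. (q i, r i, M (q i) (r i)))"

text \<open>
  If a group has fewer than \<open>\<nu>\<close> members, \<^const>\<open>take\<close> returns all of them.
\<close>

definition balanced_sample ::
    "nat \<Rightarrow> ('x \<Rightarrow> bool) \<Rightarrow> 'x collection \<Rightarrow> nat \<Rightarrow> nat set pmf" where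
  "balanced_sample n s Q \<nu> =
     map_pmf (\<lambda>(xs, ys). set (take \<nu> xs) \<union> set (take \<nu> ys))
       (pair_pmf (pmf_of_set (permutations_of_set (group n s Q False)))
                 (pmf_of_set (permutations_of_set (group n s Q True))))"

text \<open>
  Everything a malicious prover decides on.  The answers given to the clients, the authenticated
  collection and the announced gap are fixed before the sample is drawn.  The last field maps the
  drawn sample to the one the prover actually uses.
\<close>

record 'x prover =
  answer :: "nat \<Rightarrow> bool"
  authenticated :: "'x collection"
  announced_gap :: real
  used_sample :: "nat set \<Rightarrow> nat set"

definition attribute_check ::
    "('x \<Rightarrow> bool) \<Rightarrow> (nat \<Rightarrow> 'x) \<Rightarrow> 'x prover \<Rightarrow> nat \<Rightarrow> bool" where
  "attribute_check s q P i \<longleftrightarrow> s (query (authenticated P i)) = s (q i)"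

definition commitment_check ::
    "(nat \<Rightarrow> 'x) \<Rightarrow> (nat \<Rightarrow> bool list) \<Rightarrow> 'x prover \<Rightarrow> nat \<Rightarrow> bool" where
  "commitment_check q r P i \<longleftrightarrow> authenticated P i = (q i, r i, answer P i)"

definition inference_check :: "'x model \<Rightarrow> 'x prover \<Rightarrow> nat \<Rightarrow> bool" where
  "inference_check M P i \<longleftrightarrow>
     outcome (authenticated P i) = M (query (authenticated P i)) (seed (authenticated P i))"

text \<open>
  The cryptographic primitives are ideal: the prover is caught when the announced gap or the used
  sample is not the prescribed one, and whenever one of the checks fails.  Comparing the measured
  gap with the public threshold is the outcome of the audit and does not count as being caught.
\<close>

definition caught ::
    "nat \<Rightarrow> 'x model \<Rightarrow> ('x \<Rightarrow> bool) \<Rightarrow> (nat \<Rightarrow> 'x) \<Rightarrow> (nat \<Rightarrow> bool list) \<Rightarrow> 'x prover \<Rightarrow> nat set \<Rightarrow> bool"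
  where
  "caught n M s q r P S \<longleftrightarrow>
     announced_gap P \<noteq> parity_gap n s (authenticated P) \<or>
     used_sample P S \<noteq> S \<or>
     (\<exists>i\<in>{1..n}. \<not> attribute_check s q P i) \<or>
     (\<exists>i\<in>used_sample P S. \<not> commitment_check q r P i \<or> \<not> inference_check M P i)"

definition catch_probability ::
    "nat \<Rightarrow> 'x model \<Rightarrow> ('x \<Rightarrow> bool) \<Rightarrow> (nat \<Rightarrow> 'x) \<Rightarrow> (nat \<Rightarrow> bool list) \<Rightarrow> nat \<Rightarrow> 'x prover \<Rightarrow> real"
  where
  "catch_probability n M s q r \<nu> P =
     measure_pmf.prob (balanced_sample n s (authenticated P) \<nu>) {S. caught n M s q r P S}"

end

(* If the attribute check fails somewhere, the prover is always caught; otherwise both collections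
   have the same groups.  Call an index bad if it would fail a check when sampled.  An index that is
   not bad carries the honest answer, so within a group the positive rate moves by at most the
   fraction of bad indices, and the gap by at most the sum of the two fractions.  Hence some group
   has a fraction of at least \<epsilon>/2 bad indices, and sampling \<nu> of its members without
   replacement misses all of them with probability at most (1 - \<epsilon>/2)^\<nu>. *)
theory Submission
  imports Defs
begin

lemma finite_group [simp]: "finite (group n s Q a)"
  by (simp add: group_def)

lemma positive_rate_bounds: "0 \<le> positive_rate n s Q a" "positive_rate n s Q a \<le> 1"
proof -
  have "(\<Sum>i\<in>group n s Q a. of_bool (outcome (Q i))) \<le> (\<Sum>i\<in>group n s Q a. 1 :: real)"
    by (intro sum_mono) auto
  then show "positive_rate n s Q a \<le> 1"
    unfolding positive_rate_def by (intro divide_le_eq_1[THEN iffD2]) auto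
  show "0 \<le> positive_rate n s Q a"
    unfolding positive_rate_def by (intro divide_nonneg_nonneg sum_nonneg) auto
qed

lemma parity_gap_bounds: "0 \<le> parity_gap n s Q" "parity_gap n s Q \<le> 1"
  using positive_rate_bounds[of n s Q False] positive_rate_bounds[of n s Q True]
  unfolding parity_gap_def by linarith+

text \<open>Equal groups give both rates the same denominator, and each disagreeing index shifts the
  numerator by at most 1. \<open>B\<close> may be a proper superset of the disagreements, since an
  index can fail a check and still carry the honest output.\<close>

lemma positive_rate_diff_le:
  assumes "group n s Q' a = group n s Q a"
    and "{i \<in> group n s Q a. outcome (Q i) \<noteq> outcome (Q' i)} \<subseteq> B" and "finite B"
  shows "\<bar>positive_rate n s Q a - positive_rate n s Q' a\<bar> \<le> card B / card (group n s Q a)"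
proof -
  let ?G = "group n s Q a" and ?o = "\<lambda>Q i. of_bool (outcome (Q i)) :: real"
  have "\<bar>(\<Sum>i\<in>?G. ?o Q i) - (\<Sum>i\<in>?G. ?o Q' i)\<bar> \<le> (\<Sum>i\<in>?G. \<bar>?o Q i - ?o Q' i\<bar>)"
    by (simp only: sum_subtractf[symmetric] sum_abs)
  also have "\<dots> = (\<Sum>i\<in>?G. if outcome (Q i) \<noteq> outcome (Q' i) then 1 else 0)"
    by (intro sum.cong) auto
  also have "\<dots> = card {i \<in> ?G. outcome (Q i) \<noteq> outcome (Q' i)}"
    by (subst sum.If_cases) (auto simp: Int_def)
  also have "\<dots> \<le> card B"
    using assms(2,3) by (simp add: card_mono)
  finally show ?thesis
    by (simp add: positive_rate_def assms(1) diff_divide_distrib[symmetric] abs_divide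
        divide_right_mono)
qed

text \<open>Split off the head \<open>x\<close>: it must lie in \<open>A - B\<close>, and the tail
  is a permutation of \<open>A - {x}\<close> whose prefix again avoids \<open>B\<close>. Since
  \<open>x\<close> is outside \<open>B\<close>, removing it never lowers the fraction of
  \<open>B\<close>, so each draw costs a factor of at most
  \<open>1 - card B / card A\<close>.\<close>

lemma card_permutations_prefix_avoid_le:
  assumes "finite A" "B \<subseteq> A"
  shows "real (card {xs \<in> permutations_of_set A. set (take m xs) \<inter> B = {}})
           \<le> fact (card A) * (1 - card B / card A) ^ m"
  using assms
proof (induction m arbitrary: A)
  case 0
  then show ?case by simp
next
  case (Suc m)
  let ?N = "\<lambda>A m. {xs \<in> permutations_of_set A. set (take m xs) \<inter> B = {}}"
  have finB: "finite B" using Suc.prems finite_subset by blast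
  show ?case
  proof (cases "A = {}")
    case True
    \<comment> \<open>Here \<open>B\<close> is empty and \<open>0 / 0 = 0\<close>, so both sides are
      1.\<close>
    then show ?thesis using Suc.prems by simp
  next
    case False
    define c where "c = 1 - card B / card A"
    have cA: "card A > 0" using False Suc.prems by (simp add: card_gt_0_iff)
    have cB: "card B \<le> card A" using Suc.prems by (simp add: card_mono)
    have "?N A (Suc m) = (\<Union>x\<in>A - B. (#) x ` ?N (A - {x}) m)"
      using False by (auto simp: permutations_of_set_nonempty)
    then have "card (?N A (Suc m)) \<le> (\<Sum>x\<in>A - B. card ((#) x ` ?N (A - {x}) m))"
      using Suc.prems by (simp add: card_UN_le)
    also have "\<dots> = (\<Sum>x\<in>A - B. card (?N (A - {x}) m))"
      by (simp add: card_image)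
    finally have "real (card (?N A (Suc m))) \<le> real (\<Sum>x\<in>A - B. card (?N (A - {x}) m))"
      by (rule of_nat_mono)
    also have "\<dots> = (\<Sum>x\<in>A - B. real (card (?N (A - {x}) m)))"
      by (rule of_nat_sum)
    also have "\<dots> \<le> (\<Sum>x\<in>A - B. fact (card A - 1) * c ^ m)"
    proof (intro sum_mono)
      fix x assume x: "x \<in> A - B"
      then have sub: "B \<subseteq> A - {x}" using Suc.prems by auto
      have card': "card (A - {x}) = card A - 1" using x by simp
      have le: "card B \<le> card A - 1"
        using card_mono[OF _ sub] Suc.prems card' by simp
      have "real (card (?N (A - {x}) m)) \<le> fact (card A - 1) * (1 - card B / real (card A - 1)) ^ m"
        using Suc.IH[OF _ sub] Suc.prems card' by simp
      also have "\<dots> \<le> fact (card A - 1) * c ^ m"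
      proof (intro mult_left_mono power_mono)
        show "0 \<le> 1 - real (card B) / real (card A - 1)"
          using le by (auto simp: divide_le_eq_1)
        have "real (card B) / card A \<le> card B / real (card A - 1)"
        \<comment> \<open>For \<open>card A = 1\<close> the right-hand denominator is 0, but
          \<open>le\<close> forces \<open>card B = 0\<close>, so both quotients vanish.\<close>
        proof (cases "card A = 1")
          case True
          then show ?thesis using le by simp
        next
          case False
          then show ?thesis using cA by (intro divide_left_mono) auto
        qed
        then show "1 - real (card B) / real (card A - 1) \<le> c" by (simp add: c_def)
      qed simp
      finally show "real (card (?N (A - {x}) m)) \<le> fact (card A - 1) * c ^ m" .
    qed
    also have "\<dots> = (real (card A) - card B) * fact (card A - 1) * c ^ m"
      using Suc.prems cB finB by (simp add: card_Diff_subset of_nat_diff)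
    \<comment> \<open>The number of admissible heads supplies the missing factor \<open>c\<close>,
      and its other factor \<open>card A\<close> completes the factorial.\<close>
    also have "real (card A) - card B = card A * c"
      using cA by (simp add: c_def right_diff_distrib)
    also have "card A * c * fact (card A - 1) * c ^ m = fact (card A) * c ^ Suc m"
      using cA by (simp add: fact_reduce[of "card A"])
    finally show ?thesis by (simp only: c_def)
  qed
qed

lemma prob_permutation_prefix_avoid_le:
  assumes "finite A" "B \<subseteq> A"
  shows "measure_pmf.prob (pmf_of_set (permutations_of_set A)) {xs. set (take m xs) \<inter> B = {}}
           \<le> (1 - card B / card A) ^ m"
proof -
  have "permutations_of_set A \<inter> {xs. set (take m xs) \<inter> B = {}}
      = {xs \<in> permutations_of_set A. set (take m xs) \<inter> B = {}}"
    by auto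
  then show ?thesis
    using card_permutations_prefix_avoid_le[OF assms, of m] assms
    by (simp add: measure_pmf_of_set pos_divide_le_eq mult.commute)
qed

text \<open>Forgetting the draw from the other group only enlarges the event, and the marginal of
  the product on group \<open>a\<close> is the uniform permutation of that group.\<close>

lemma prob_balanced_sample_avoid_le:
  assumes "B \<subseteq> group n s Q a"
  shows "measure_pmf.prob (balanced_sample n s Q \<nu>) {S. S \<inter> B = {}}
           \<le> (1 - card B / card (group n s Q a)) ^ \<nu>"
proof -
  let ?p = "\<lambda>a. pmf_of_set (permutations_of_set (group n s Q a))"
  let ?E = "{xs. set (take \<nu> xs) \<inter> B = {}}"
  let ?f = "if a then snd else fst :: nat list \<times> nat list \<Rightarrow> nat list"
  have "measure_pmf.prob (balanced_sample n s Q \<nu>) {S. S \<inter> B = {}}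
      \<le> measure_pmf.prob (pair_pmf (?p False) (?p True)) (?f -` ?E)"
    unfolding balanced_sample_def measure_map_pmf
    by (intro measure_pmf.finite_measure_mono) auto
  also have "\<dots> = measure_pmf.prob (map_pmf ?f (pair_pmf (?p False) (?p True))) ?E"
    by (simp only: measure_map_pmf)
  also have "map_pmf ?f (pair_pmf (?p False) (?p True)) = ?p a"
    by (cases a) (simp_all add: map_fst_pair_pmf map_snd_pair_pmf)
  also have "measure_pmf.prob (?p a) ?E \<le> (1 - card B / card (group n s Q a)) ^ \<nu>"
    using assms by (intro prob_permutation_prefix_avoid_le) auto
  finally show ?thesis .
qed

theorem theorem4p1:
  fixes n k \<nu> :: nat
    and M :: "'x model"
    and s :: "'x \<Rightarrow> bool"
    and q :: "nat \<Rightarrow> 'x"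
    and r :: "nat \<Rightarrow> bool list"
    and P :: "'x prover"
    and \<epsilon> :: real
  assumes "valid_collection n k s (honest_collection M q r)"
    and "valid_collection n k s (authenticated P)"
    and "\<epsilon> = \<bar>parity_gap n s (honest_collection M q r) - parity_gap n s (authenticated P)\<bar>"
    and "\<epsilon> > 0"
  shows "catch_probability n M s q r \<nu> P \<ge> 1 - (1 - \<epsilon> / 2) ^ \<nu>"
proof (cases "\<exists>i\<in>{1..n}. \<not> attribute_check s q P i")
  case True
  then have "catch_probability n M s q r \<nu> P = 1"
    by (simp add: catch_probability_def caught_def)
  \<comment> \<open>This makes the base \<open>1 - \<epsilon> / 2\<close> nonnegative, so the
    claimed bound is at most 1.\<close>
  moreover have "\<epsilon> \<le> 1"
    using assms(3) parity_gap_bounds[of n s "honest_collection M q r"]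
      parity_gap_bounds[of n s "authenticated P"] by linarith
  ultimately show ?thesis by simp
next
  case False
  let ?H = "honest_collection M q r" and ?Q = "authenticated P"
  define bad where
    "bad a = {i \<in> group n s ?Q a. \<not> commitment_check q r P i \<or> \<not> inference_check M P i}" for a
  define b where "b a = card (bad a) / card (group n s ?Q a)" for a
  have groups: "group n s ?H a = group n s ?Q a" for a
    using False by (auto simp: group_def attribute_check_def honest_collection_def)
  \<comment> \<open>The commitment check fixes the query and seed but would admit a dishonest
    \<open>answer P i\<close>; adding the inference check forces the output
    \<open>M (q i) (r i)\<close>.\<close>
  have rate: "\<bar>positive_rate n s ?Q a - positive_rate n s ?H a\<bar> \<le> b a" for a
    unfolding b_def
    by (intro positive_rate_diff_le groups)
      (auto simp: bad_def commitment_check_def inference_check_def honest_collection_def)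
  have "\<epsilon> \<le> b False + b True"
    using rate[of False] rate[of True] assms(3) unfolding parity_gap_def by linarith
  then obtain a where a: "\<epsilon> / 2 \<le> b a"
    by (cases "\<epsilon> / 2 \<le> b False") (auto intro: that[of False] that[of True])
  \<comment> \<open>Monotonicity of the power below needs the smaller base \<open>1 - b a\<close> to
    be nonnegative.\<close>
  have "card (bad a) \<le> card (group n s ?Q a)"
    by (intro card_mono) (auto simp: bad_def)
  then have "b a \<le> 1"
    by (auto simp: b_def divide_le_eq_1 card_gt_0_iff)
  let ?p = "balanced_sample n s ?Q \<nu>"
  have "1 - catch_probability n M s q r \<nu> P = measure_pmf.prob ?p {S. \<not> caught n M s q r P S}"
    unfolding catch_probability_def
    by (subst measure_pmf.prob_compl[symmetric]) (auto intro: arg_cong[where f = "measure _"])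
  \<comment> \<open>Substituting another sample is itself caught, so an uncaught run has
    \<open>used_sample P S = S\<close> and every index of \<open>S\<close> was checked.\<close>
  also have "\<dots> \<le> measure_pmf.prob ?p {S. S \<inter> bad a = {}}"
    by (intro measure_pmf.finite_measure_mono) (auto simp: caught_def bad_def)
  also have "\<dots> \<le> (1 - b a) ^ \<nu>"
    unfolding b_def by (rule prob_balanced_sample_avoid_le) (auto simp: bad_def)
  also have "\<dots> \<le> (1 - \<epsilon> / 2) ^ \<nu>"
    using a \<open>b a \<le> 1\<close> by (intro power_mono) auto
  finally show ?thesis by simp
qed

end
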